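(* Let $\mathcal{U}\subset\mathbb{R}^n$ and $\mathcal{V}\subset\mathbb{R}^m$ be such that $\mathcal{U}\times\mathcal{V}$ is open, let $F:\mathbb{R}^n\times\mathbb{R}^m\to\mathbb{R}^m$ be path differentiable on $\mathcal{U}\times\mathcal{V}$, and let $J_F$ be a conservative Jacobian for $F$. Let $G:\mathcal{U}\to\mathcal{V}$ be a locally Lipschitz function such that, for each $x\in\mathcal{U}$, $F(x,G(x))=0$. Assume that for each $x\in\mathcal{U}$ and each $[A\ B]\in J_F(x,G(x))$ (with $A\in\mathbb{R}^{m\times n}$, $B\in\mathbb{R}^{m\times m}$), the matrix $B$ is invertible. Then $G:\mathcal{U}\to\mathcal{V}$ is path differentiable, with conservative Jacobian given, for each $x\in\mathcal{U}$, by $$J_G(x)=\left\{-B^{-1}A \;:\; [A\ B]\in J_F(x,G(x))\right\}.$$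
   Context: Conservative Jacobian: let $\mathcal{O}\subset\mathbb{R}^p$ be open and $H:\mathcal{O}\to\mathbb{R}^q$ locally Lipschitz. A set-valued map $J_H:\mathcal{O}\rightrightarrows\mathbb{R}^{q\times p}$ is a conservative Jacobian for $H$ (on $\mathcal{O}$) if it has nonempty values, has a closed graph, is locally bounded, and for every absolutely continuous curve $\gamma:[0,1]\to\mathcal{O}$ one has, for almost every $t\in[0,1]$, $\frac{d}{dt}H(\gamma(t))=M\dot\gamma(t)$ for all $M\in J_H(\gamma(t))$. A locally Lipschitz function is path differentiable (on $\mathcal{O}$) if it has a conservative Jacobian (on $\mathcal{O}$). $[A\ B]$ denotes columnwise concatenation of matrices. *)

theory Defs
  imports "HOL-Analysis.Analysis"
begin

definition locally_lipschitz_on :: "'a::metric_space set \<Rightarrow> ('a \<Rightarrow> 'b::metric_space) \<Rightarrow> bool" where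
  "locally_lipschitz_on S f \<longleftrightarrow>
     (\<forall>x\<in>S. \<exists>u>0. \<exists>L. L-lipschitz_on (cball x u \<inter> S) f)"

(* The family of non-overlapping intervals is a finite set of pairs of endpoints. Degenerate
   pairs (a, a) are allowed; they contribute nothing to either sum. *)
definition absolutely_continuous_on_interval ::
    "real \<Rightarrow> real \<Rightarrow> (real \<Rightarrow> 'a::metric_space) \<Rightarrow> bool" where
  "absolutely_continuous_on_interval a b f \<longleftrightarrow>
     (\<forall>\<epsilon>>0. \<exists>\<delta>>0. \<forall>D :: (real \<times> real) set.
        finite D \<and>
        (\<forall>(s, t)\<in>D. a \<le> s \<and> s \<le> t \<and> t \<le> b) \<and>
        disjoint_family_on (\<lambda>(s, t). {s<..<t}) D \<and>
        (\<Sum>(s, t)\<in>D. t - s) < \<delta>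
        \<longrightarrow> (\<Sum>(s, t)\<in>D. dist (f s) (f t)) < \<epsilon>)"

(* The values of J outside S play no role. In particular the graph is that of J restricted to S,
   and it is closed relative to S \<times> UNIV (S itself is open, hence in general not closed).
   Both derivatives are required to exist; they are one-sided at t = 0 and t = 1. *)
definition conservative_jacobian ::
    "(real^'p) set \<Rightarrow> (real^'p \<Rightarrow> real^'q) \<Rightarrow> (real^'p \<Rightarrow> (real^'p^'q) set) \<Rightarrow> bool" where
  "conservative_jacobian S H J \<longleftrightarrow>
     open S \<and>
     locally_lipschitz_on S H \<and>
     (\<forall>x\<in>S. J x \<noteq> {}) \<and>
     closedin (top_of_set (S \<times> UNIV)) {(x, M). x \<in> S \<and> M \<in> J x} \<and>
     (\<forall>x\<in>S. \<exists>u>0. bounded (\<Union>y\<in>ball x u \<inter> S. J y)) \<and>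
     (\<forall>\<gamma> :: real \<Rightarrow> real^'p.
        absolutely_continuous_on_interval 0 1 \<gamma> \<and> \<gamma> ` {0..1} \<subseteq> S \<longrightarrow>
        (AE t in lebesgue_on {0..1}. \<exists>v w.
           (\<gamma> has_vector_derivative v) (at t within {0..1}) \<and>
           ((\<lambda>s. H (\<gamma> s)) has_vector_derivative w) (at t within {0..1}) \<and>
           (\<forall>M\<in>J (\<gamma> t). w = M *v v)))"

definition path_differentiable_on :: "(real^'p) set \<Rightarrow> (real^'p \<Rightarrow> real^'q) \<Rightarrow> bool" where
  "path_differentiable_on S H \<longleftrightarrow>
     locally_lipschitz_on S H \<and> (\<exists>J. conservative_jacobian S H J)"

(* The space R^n \<times> R^m is identified with R^(n+m), whose coordinates are indexed by the
   sum type 'n + 'm. *)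
definition vcat :: "(real^'n) \<times> (real^'m) \<Rightarrow> real^('n + 'm)" where
  "vcat = (\<lambda>(x, y). \<chi> i. case i of Inl j \<Rightarrow> x $ j | Inr k \<Rightarrow> y $ k)"

definition hcat :: "real^'n^'q \<Rightarrow> real^'m^'q \<Rightarrow> real^('n + 'm)^'q" where
  "hcat A B = (\<chi> r c. case c of Inl j \<Rightarrow> A $ r $ j | Inr k \<Rightarrow> B $ r $ k)"

lemma hcat_mult_vcat: "hcat A B *v vcat (x, y) = A *v x + B *v y"
  by (simp add: vec_eq_iff matrix_vector_mult_def hcat_def vcat_def UNIV_Plus_UNIV [symmetric]
      sum.Plus del: UNIV_Plus_UNIV)

end

theory Submission
  imports Defs
begin

text \<open>The curve \<open>t \<mapsto> (\<gamma> t, G (\<gamma> t))\<close> is absolutely continuous and \<open>F\<close> vanishes along it, so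
  conservativity of \<open>[A B]\<close> gives \<open>A \<gamma>' + B (G \<circ> \<gamma>)' = 0\<close> almost everywhere, which is solved for
  \<open>(G \<circ> \<gamma>)'\<close>. Closedness of the graph and local boundedness of \<open>J\<^sub>G\<close> use the characterisation
  \<open>B M = - A\<close> of \<open>M = - B\<inverse> A\<close> and subsequences of \<open>[A B]\<close>, so that continuity of matrix
  inversion is not needed.\<close>

subsection \<open>Block vectors and matrices\<close>

text \<open>With \<open>hfst\<close> and \<open>hsnd\<close> inverting \<open>hcat\<close>, a pair
  of blocks becomes a single matrix \<open>P\<close>, to which choice and subsequence arguments
  apply directly.\<close>

definition hfst :: "real^('n::finite + 'm::finite)^'q \<Rightarrow> real^'n^'q" where
  "hfst P = (\<chi> r j. P $ r $ Inl j)"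

definition hsnd :: "real^('n::finite + 'm::finite)^'q \<Rightarrow> real^'m^'q" where
  "hsnd P = (\<chi> r k. P $ r $ Inr k)"

lemma hcat_hfst_hsnd [simp]: "hcat (hfst P) (hsnd P) = P"
  by (simp add: hcat_def hfst_def hsnd_def vec_eq_iff split: sum.split)

lemma hfst_hcat [simp]: "hfst (hcat A B) = A"
  and hsnd_hcat [simp]: "hsnd (hcat A B) = B"
  by (simp_all add: hcat_def hfst_def hsnd_def vec_eq_iff)

text \<open>Together with the rule for products, this allows limits to be taken on both sides of
  \<open>hsnd P ** M = - hfst P\<close>.\<close>

lemma tendsto_hfst [tendsto_intros]: "(f \<longlongrightarrow> P) F \<Longrightarrow> ((\<lambda>x. hfst (f x)) \<longlongrightarrow> hfst P) F"
  and tendsto_hsnd [tendsto_intros]: "(f \<longlongrightarrow> P) F \<Longrightarrow> ((\<lambda>x. hsnd (f x)) \<longlongrightarrow> hsnd P) F"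
  unfolding hfst_def hsnd_def by (intro tendsto_intros; assumption)+

lemma tendsto_matrix_mult [tendsto_intros]:
  fixes f :: "'x \<Rightarrow> real^'k^'q" and g :: "'x \<Rightarrow> real^'n^'k"
  assumes "(f \<longlongrightarrow> A) F" and "(g \<longlongrightarrow> B) F"
  shows "((\<lambda>x. f x ** g x) \<longlongrightarrow> A ** B) F"
  unfolding matrix_matrix_mult_def by (intro tendsto_intros assms)

lemma vcat_nth [simp]: "vcat p $ Inl j = fst p $ j" "vcat p $ Inr k = snd p $ k"
  by (simp_all add: vcat_def split: prod.split)

lemma vcat_cases: "\<exists>x y. v = vcat (x, y)"
proof (intro exI)
  show "v = vcat (\<chi> j. v $ Inl j, \<chi> k. v $ Inr k)"
    by (simp add: vec_eq_iff vcat_def split: sum.split)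
qed

lemma bounded_linear_vcat: "bounded_linear vcat"
  by (rule bounded_linearI') (simp_all add: vec_eq_iff vcat_def split: sum.split prod.split)

text \<open>The two coordinate projections are bounded linear and so commute with
  differentiation.\<close>

lemma has_vector_derivative_vcatD:
  fixes f :: "real \<Rightarrow> real^'n" and g :: "real \<Rightarrow> real^'m"
  assumes "((\<lambda>s. vcat (f s, g s)) has_vector_derivative vcat (v, w)) F"
  shows "(f has_vector_derivative v) F" and "(g has_vector_derivative w) F"
proof -
  have L: "bounded_linear (\<lambda>z::real^('n + 'm). \<chi> j. z $ Inl j)"
    and R: "bounded_linear (\<lambda>z::real^('n + 'm). \<chi> k. z $ Inr k)"
    by (rule bounded_linearI'; simp add: vec_eq_iff)+
  show "(f has_vector_derivative v) F"
    using bounded_linear.has_vector_derivative[OF L assms] by simp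
  show "(g has_vector_derivative w) F"
    using bounded_linear.has_vector_derivative[OF R assms] by simp
qed

lemma matrix_inv_cancel:
  fixes B :: "'a::semiring_1^'n^'n"
  assumes "invertible B"
  shows "B ** matrix_inv B = mat 1" and "matrix_inv B ** B = mat 1"
  using someI_ex[OF assms[unfolded invertible_def]] by (simp_all add: matrix_inv_def)

text \<open>Multiplying by the inverse from either side passes between the two forms. The left one
  is linear in \<open>A\<close> and \<open>M\<close> and contains no inverse, so it survives limits
  and rescaling.\<close>

lemma matrix_mul_eq_minus_iff:
  fixes B :: "real^'m^'m" and A M :: "real^'n^'m"
  assumes "invertible B"
  shows "B ** M = - A \<longleftrightarrow> M = - (matrix_inv B ** A)"
proof -
  have minus: "C ** (- A) = - (C ** A)" for C :: "real^'m^'m"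
    by (simp add: matrix_matrix_mult_def vec_eq_iff sum_negf)
  show ?thesis
    by (metis assms matrix_inv_cancel matrix_mul_assoc matrix_mul_lid minus)
qed

subsection \<open>Lipschitz maps and absolutely continuous curves\<close>

lemma locally_lipschitz_on_imp_continuous_on:
  assumes "locally_lipschitz_on S f"
  shows "continuous_on S f"
  unfolding continuous_on_eq_continuous_within
proof
  fix x assume x: "x \<in> S"
  then obtain u L where u: "u > 0" and L: "L-lipschitz_on (cball x u \<inter> S) f"
    using assms unfolding locally_lipschitz_on_def by blast
  have "continuous (at x within (cball x u \<inter> S)) f"
    using lipschitz_on_continuous_within[OF L] x u by auto
  moreover have "at x within (cball x u \<inter> S) = at x within S"
    by (rule at_within_nhd[where S="ball x u"]) (use u in auto)
  ultimately show "continuous (at x within S) f"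
    by (simp add: continuous_within)
qed

text \<open>By compactness, unbounded difference quotients would need pairs of points accumulating
  at a common point of \<open>K\<close>, against the local bound there. The map is treated as a
  family constant in a parameter ranging over \<open>K\<close>; empty \<open>K\<close> is settled
  separately.\<close>

lemma locally_lipschitz_on_compact:
  assumes "locally_lipschitz_on S f" and "compact K" and "K \<subseteq> S"
  obtains L where "L-lipschitz_on K f"
proof -
  have "local_lipschitz K K (\<lambda>_. f)"
  proof (rule local_lipschitzI)
    fix t x assume "x \<in> K"
    then obtain u L where "u > 0" "L-lipschitz_on (cball x u \<inter> S) f"
      using assms unfolding locally_lipschitz_on_def by blast
    moreover have "cball x u \<inter> K \<subseteq> cball x u \<inter> S"
      using assms by blast
    ultimately show "\<exists>u>0. \<exists>L. \<forall>t\<in>cball t u \<inter> K. L-lipschitz_on (cball x u \<inter> K) f"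
      by (meson lipschitz_on_subset)
  qed
  then show ?thesis
    using local_lipschitz_compact_implies_lipschitz[of K K "\<lambda>_. f"] assms(2) that
    by (metis continuous_on_const equals0I lipschitz_on_empty_iff order_refl)
qed

text \<open>A family with a single interval suffices; its smaller endpoint must come first, hence
  the case split on the order of \<open>x\<close> and \<open>y\<close>.\<close>

lemma absolutely_continuous_on_interval_imp_continuous_on:
  assumes "absolutely_continuous_on_interval a b f"
  shows "continuous_on {a..b} f"
  unfolding continuous_on_iff
proof (intro ballI allI impI)
  fix x and e :: real assume x: "x \<in> {a..b}" and e: "e > 0"
  obtain d where d: "d > 0" and D: "\<And>D. finite D \<and> (\<forall>(s, t)\<in>D. a \<le> s \<and> s \<le> t \<and> t \<le> b) \<and>
        disjoint_family_on (\<lambda>(s, t). {s<..<t}) D \<and> (\<Sum>(s, t)\<in>D. t - s) < d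
        \<Longrightarrow> (\<Sum>(s, t)\<in>D. dist (f s) (f t)) < e"
    using assms e unfolding absolutely_continuous_on_interval_def by meson
  have "dist (f y) (f x) < e" if "y \<in> {a..b}" "dist y x < d" for y
  proof (cases "x \<le> y")
    case True
    then show ?thesis
      using D[of "{(x, y)}"] that x by (simp add: disjoint_family_on_def dist_real_def dist_commute)
  next
    case False
    then show ?thesis
      using D[of "{(y, x)}"] that x by (simp add: disjoint_family_on_def dist_real_def)
  qed
  then show "\<exists>d>0. \<forall>y\<in>{a..b}. dist y x < d \<longrightarrow> dist (f y) (f x) < e"
    using d by blast
qed

lemma absolutely_continuous_on_interval_lipschitz_compose:
  assumes f: "absolutely_continuous_on_interval a b f" and h: "L-lipschitz_on (f ` {a..b}) h"
  shows "absolutely_continuous_on_interval a b (\<lambda>t. h (f t))"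
  unfolding absolutely_continuous_on_interval_def
proof (intro allI impI)
  fix e :: real assume e: "e > 0"
  have L: "L \<ge> 0"
    using h lipschitz_on_nonneg by blast
  \<comment> \<open>Dividing by \<open>L + 1\<close> instead of \<open>L\<close> covers the case
    \<open>L = 0\<close>; the factor is recovered when the increments are summed.\<close>
  then obtain d where d: "d > 0" and D: "\<And>D. finite D \<and>
        (\<forall>(s, t)\<in>D. a \<le> s \<and> s \<le> t \<and> t \<le> b) \<and>
        disjoint_family_on (\<lambda>(s, t). {s<..<t}) D \<and> (\<Sum>(s, t)\<in>D. t - s) < d
        \<Longrightarrow> (\<Sum>(s, t)\<in>D. dist (f s) (f t)) < e / (L + 1)"
    using f[unfolded absolutely_continuous_on_interval_def, rule_format, of "e / (L + 1)"] e
    by auto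
  have "(\<Sum>(s, t)\<in>D. dist (h (f s)) (h (f t))) < e"
    if H: "finite D \<and> (\<forall>(s, t)\<in>D. a \<le> s \<and> s \<le> t \<and> t \<le> b) \<and>
        disjoint_family_on (\<lambda>(s, t). {s<..<t}) D \<and> (\<Sum>(s, t)\<in>D. t - s) < d" for D
  proof -
    have le: "dist (h (f s)) (h (f t)) \<le> (L + 1) * dist (f s) (f t)" if "(s, t) \<in> D" for s t
    proof -
      have "s \<in> {a..b}" "t \<in> {a..b}"
        using H that by fastforce+
      then have "dist (h (f s)) (h (f t)) \<le> L * dist (f s) (f t)"
        using lipschitz_onD[OF h] by blast
      then show ?thesis
        by (simp add: algebra_simps add_increasing)
    qed
    have "(\<Sum>(s, t)\<in>D. dist (h (f s)) (h (f t))) \<le> (\<Sum>(s, t)\<in>D. (L + 1) * dist (f s) (f t))"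
      by (rule sum_mono) (use le in auto)
    also have "\<dots> = (L + 1) * (\<Sum>(s, t)\<in>D. dist (f s) (f t))"
      by (simp add: sum_distrib_left case_prod_unfold)
    also have "\<dots> < e"
      using D[OF H] L by (simp add: field_simps)
    finally show ?thesis .
  qed
  then show "\<exists>\<delta>>0. \<forall>D. finite D \<and> (\<forall>(s, t)\<in>D. a \<le> s \<and> s \<le> t \<and> t \<le> b) \<and>
      disjoint_family_on (\<lambda>(s, t). {s<..<t}) D \<and> (\<Sum>(s, t)\<in>D. t - s) < \<delta> \<longrightarrow>
      (\<Sum>(s, t)\<in>D. dist (h (f s)) (h (f t))) < e"
    using d by blast
qed

text \<open>The trace of the curve is compact, so one Lipschitz constant for \<open>G\<close> serves
  along all of it, and the lift to the graph is a Lipschitz image of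
  \<open>\<gamma>\<close>.\<close>

lemma absolutely_continuous_on_interval_vcat_graph:
  assumes G: "locally_lipschitz_on U G"
    and \<gamma>: "absolutely_continuous_on_interval a b \<gamma>" "\<gamma> ` {a..b} \<subseteq> U"
  shows "absolutely_continuous_on_interval a b (\<lambda>t. vcat (\<gamma> t, G (\<gamma> t)))"
proof -
  have "compact (\<gamma> ` {a..b})"
    using absolutely_continuous_on_interval_imp_continuous_on[OF \<gamma>(1)]
    by (rule compact_continuous_image) simp
  then obtain L where "L-lipschitz_on (\<gamma> ` {a..b}) G"
    using locally_lipschitz_on_compact[OF G] \<gamma>(2) by metis
  from lipschitz_on_Pair[OF lipschitz_on_id this]
  obtain L1 where L1: "L1-lipschitz_on (\<gamma> ` {a..b}) (\<lambda>x. (x, G x))"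
    by blast
  obtain L2 where "L2-lipschitz_on ((\<lambda>x. (x, G x)) ` \<gamma> ` {a..b}) vcat"
    by (rule bounded_linear.lipschitz_boundE[OF bounded_linear_vcat])
  from lipschitz_on_compose2[OF L1 this] show ?thesis
    by (rule absolutely_continuous_on_interval_lipschitz_compose[OF \<gamma>(1)])
qed

subsection \<open>The implicit conservative Jacobian\<close>

text \<open>Local boundedness gives a convergent subsequence by Bolzano-Weierstrass; the closed
  graph puts its limit into \<open>J l\<close>.\<close>

lemma conservative_jacobian_subsequence:
  fixes H :: "real^'p \<Rightarrow> real^'q"
  assumes J: "conservative_jacobian S H J"
    and z: "z \<longlonglongrightarrow> l" "l \<in> S" "\<And>n. z n \<in> S" and P: "\<And>n. P n \<in> J (z n)"
  obtains r Q where "strict_mono (r :: nat \<Rightarrow> nat)" "(P \<circ> r) \<longlonglongrightarrow> Q" "Q \<in> J l"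
proof -
  obtain u where u: "u > 0" "bounded (\<Union>y\<in>ball l u \<inter> S. J y)"
    using J z(2) unfolding conservative_jacobian_def by blast
  from z(1) u(1) have "eventually (\<lambda>n. z n \<in> ball l u) sequentially"
    by (simp add: tendsto_iff dist_commute)
  then obtain N where N: "\<And>n. n \<ge> N \<Longrightarrow> z n \<in> ball l u"
    by (auto simp: eventually_sequentially)
  \<comment> \<open>The shift by \<open>N\<close> discards the terms whose base points may lie
    outside the ball where \<open>J\<close> is bounded.\<close>
  have "range (\<lambda>n. P (n + N)) \<subseteq> (\<Union>y\<in>ball l u \<inter> S. J y)"
    using P z(3) N by force
  then obtain Q r where r: "strict_mono r" and lim: "((\<lambda>n. P (n + N)) \<circ> r) \<longlonglongrightarrow> Q"
    using bounded_imp_convergent_subsequence[OF bounded_subset[OF u(2)]] by blast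
  have r': "strict_mono (\<lambda>n. r n + N)"
    using r by (simp add: strict_mono_def)
  have lim': "(\<lambda>n. (z (r n + N), P (r n + N))) \<longlonglongrightarrow> (l, Q)"
    using lim LIMSEQ_subseq_LIMSEQ[OF z(1) r'] by (intro tendsto_Pair) (simp_all add: o_def)
  \<comment> \<open>The graph is closed only relative to \<open>S \<times> UNIV\<close>: the limit
    is found in the closed set \<open>T\<close>, and \<open>l \<in> S\<close> brings it back to the
    graph.\<close>
  obtain T where T: "closed T" "{(x, M). x \<in> S \<and> M \<in> J x} = (S \<times> UNIV) \<inter> T"
    using J unfolding conservative_jacobian_def closedin_closed by blast
  have "(l, Q) \<in> T"
    by (rule closed_sequentially[OF T(1) _ lim']) (use T(2) z(3) P in blast)
  then have "Q \<in> J l"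
    using T(2) z(2) by blast
  with that[OF r'] lim show ?thesis
    by (simp add: o_def)
qed

theorem theorem2:
  fixes U :: "(real^'n) set" and V :: "(real^'m) set"
    and F :: "real^('n + 'm) \<Rightarrow> real^'m"
    and J\<^sub>F :: "real^('n + 'm) \<Rightarrow> (real^('n + 'm)^'m) set"
    and G :: "real^'n \<Rightarrow> real^'m"
  assumes "open (U \<times> V)"
    and "path_differentiable_on (vcat ` (U \<times> V)) F"
    and "conservative_jacobian (vcat ` (U \<times> V)) F J\<^sub>F"
    and "G ` U \<subseteq> V"
    and "locally_lipschitz_on U G"
    and "\<forall>x\<in>U. F (vcat (x, G x)) = 0"
    and "\<forall>x\<in>U. \<forall>A B. hcat A B \<in> J\<^sub>F (vcat (x, G x)) \<longrightarrow> invertible B"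
  shows "path_differentiable_on U G \<and>
         conservative_jacobian U G
           (\<lambda>x. {- (matrix_inv B ** A) |A B. hcat A B \<in> J\<^sub>F (vcat (x, G x))})"
proof -

  \<comment> \<open>Reformulation of \<open>J\<close> by a linear equation, and subsequences along
    the graph of \<open>G\<close>\<close>
  define W where "W = vcat ` (U \<times> V)"
  define g where "g x = vcat (x, G x)" for x
  define J where "J x = {- (matrix_inv B ** A) |A B. hcat A B \<in> J\<^sub>F (g x)}" for x
  note JF = assms(3)[folded W_def]
  have inv: "invertible (hsnd P)" if "x \<in> U" "P \<in> J\<^sub>F (g x)" for x P
    using assms(7) that unfolding g_def by (metis hcat_hfst_hsnd)
  \<comment> \<open>Invertibility of \<open>hsnd P\<close> at points of the graph makes this an
    equivalence.\<close>
  have J_iff: "M \<in> J x \<longleftrightarrow> (\<exists>P\<in>J\<^sub>F (g x). hsnd P ** M = - hfst P)" if x: "x \<in> U" for x M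
  proof -
    have "M \<in> J x \<longleftrightarrow> (\<exists>P\<in>J\<^sub>F (g x). M = - (matrix_inv (hsnd P) ** hfst P))"
    proof
      assume "M \<in> J x"
      then obtain A B where "M = - (matrix_inv B ** A)" "hcat A B \<in> J\<^sub>F (g x)"
        unfolding J_def by blast
      then show "\<exists>P\<in>J\<^sub>F (g x). M = - (matrix_inv (hsnd P) ** hfst P)"
        by (intro bexI[of _ "hcat A B"]) simp_all
    next
      assume "\<exists>P\<in>J\<^sub>F (g x). M = - (matrix_inv (hsnd P) ** hfst P)"
      then obtain P where "M = - (matrix_inv (hsnd P) ** hfst P)"
        "hcat (hfst P) (hsnd P) \<in> J\<^sub>F (g x)"
        by auto
      then show "M \<in> J x"
        unfolding J_def by blast
    qed
    then show ?thesis
      using matrix_mul_eq_minus_iff[OF inv[OF x]] by blast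
  qed
  have gW: "g x \<in> W" if "x \<in> U" for x
    using assms(4) that unfolding g_def W_def by blast
  have contg: "continuous_on U g"
    unfolding g_def
    by (intro bounded_linear.continuous_on[OF bounded_linear_vcat] continuous_intros
        locally_lipschitz_on_imp_continuous_on assms)
  have subseq: "\<exists>r Q. strict_mono (r :: nat \<Rightarrow> nat) \<and> (P \<circ> r) \<longlonglongrightarrow> Q \<and> Q \<in> J\<^sub>F (g x)"
    if "y \<longlonglongrightarrow> x" "x \<in> U" "\<And>n. y n \<in> U" "\<And>n. P n \<in> J\<^sub>F (g (y n))" for y x P
  proof -
    have "(\<lambda>n. g (y n)) \<longlonglongrightarrow> g x"
      using contg that unfolding continuous_on_sequentially by (auto simp: o_def)
    then show ?thesis
      using conservative_jacobian_subsequence[OF JF] gW that by metis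
  qed

  \<comment> \<open>Openness of the domain and nonempty values\<close>
  have openU: "open U"
  proof (cases "U = {}")
    case False
    \<comment> \<open>The first projection of \<open>U \<times> V\<close> is \<open>U\<close> only
      if \<open>V\<close> is nonempty; a value of \<open>G\<close> ensures this.\<close>
    then have "V \<noteq> {}"
      using assms(4) by blast
    with open_image_fst[OF assms(1)] show ?thesis
      by simp
  qed simp
  have nonempty: "J x \<noteq> {}" if x: "x \<in> U" for x
  proof -
    obtain P where "P \<in> J\<^sub>F (g x)"
      using JF gW[OF x] unfolding conservative_jacobian_def by blast
    then have "- (matrix_inv (hsnd P) ** hfst P) \<in> J x"
      unfolding J_def using hcat_hfst_hsnd[of P] by fastforce
    then show ?thesis
      by blast
  qed

  \<comment> \<open>Closedness of the graph of \<open>J\<close>\<close>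
  have closed: "closedin (top_of_set (U \<times> UNIV)) {(x, M). x \<in> U \<and> M \<in> J x}"
  proof -
    have "z \<in> {(x, M). x \<in> U \<and> M \<in> J x}"
      if lim_pt: "z islimpt {(x, M). x \<in> U \<and> M \<in> J x}" and z: "z \<in> U \<times> UNIV" for z
    proof -
      obtain s where "\<forall>n. s n \<in> {(x, M). x \<in> U \<and> M \<in> J x} - {z}" and s_lim: "s \<longlonglongrightarrow> z"
        using lim_pt[unfolded islimpt_sequential] by (elim exE conjE)
      then have s: "fst (s n) \<in> U" "snd (s n) \<in> J (fst (s n))" for n
        by (auto simp: case_prod_unfold)
      obtain x M where zx: "z = (x, M)"
        by (rule prod.exhaust)
      define y N where "y n = fst (s n)" and "N n = snd (s n)" for n
      have x: "x \<in> U" and y: "\<And>n. y n \<in> U" and N: "\<And>n. N n \<in> J (y n)"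
        using s z zx unfolding y_def N_def by simp_all
      have lim: "y \<longlonglongrightarrow> x" "N \<longlonglongrightarrow> M"
        using tendsto_fst[OF s_lim] tendsto_snd[OF s_lim] unfolding y_def N_def zx by simp_all
      have "\<forall>n. \<exists>P. P \<in> J\<^sub>F (g (y n)) \<and> hsnd P ** N n = - hfst P"
        using J_iff[OF y] N by blast
      then obtain P where P: "\<And>n. P n \<in> J\<^sub>F (g (y n))" "\<And>n. hsnd (P n) ** N n = - hfst (P n)"
        unfolding choice_iff by blast
      obtain r Q where r: "strict_mono r" "(P \<circ> r) \<longlonglongrightarrow> Q" "Q \<in> J\<^sub>F (g x)"
        using subseq[OF lim(1) x y P(1)] by blast
      \<comment> \<open>The same sequence is evaluated in the limit twice, once as a product and
        once through the equation, so the equation holds for \<open>Q\<close> and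
        \<open>M\<close>.\<close>
      have "(\<lambda>n. hsnd (P (r n)) ** N (r n)) \<longlonglongrightarrow> hsnd Q ** M"
        using r(2) LIMSEQ_subseq_LIMSEQ[OF lim(2) r(1)] unfolding o_def by (intro tendsto_intros)
      moreover have "(\<lambda>n. hsnd (P (r n)) ** N (r n)) \<longlonglongrightarrow> - hfst Q"
        unfolding P(2) using r(2) unfolding o_def by (intro tendsto_intros)
      ultimately have "hsnd Q ** M = - hfst Q"
        by (rule LIMSEQ_unique)
      then show ?thesis
        using J_iff[OF x] r(3) x zx by blast
    qed
    then show ?thesis
      unfolding closedin_limpt by blast
  qed

  \<comment> \<open>Local boundedness of \<open>J\<close>\<close>
  have locbdd: "\<exists>u>0. bounded (\<Union>y\<in>ball x u \<inter> U. J y)" if x: "x \<in> U" for x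
  proof (rule ccontr)
    assume unb: "\<not> ?thesis"
    \<comment> \<open>If every radius fails, the radii \<open>1 / Suc n\<close> and bounds
      \<open>Suc n\<close> give points tending to \<open>x\<close> with matrices of unbounded norm;
      \<open>Suc\<close> keeps the radius positive. Point and matrix are paired so that one choice
      yields both sequences.\<close>
    have "\<forall>n. \<exists>p. fst p \<in> ball x (1 / real (Suc n)) \<inter> U \<and> snd p \<in> J (fst p) \<and>
        norm (snd p) > real (Suc n)"
    proof
      fix n
      have "\<not> bounded (\<Union>y\<in>ball x (1 / real (Suc n)) \<inter> U. J y)"
        using unb by simp
      then obtain y M where "y \<in> ball x (1 / real (Suc n)) \<inter> U" "M \<in> J y" "norm M > real (Suc n)"
        unfolding bounded_iff by (meson UN_E not_le)
      then show "\<exists>p. fst p \<in> ball x (1 / real (Suc n)) \<inter> U \<and> snd p \<in> J (fst p) \<and>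
          norm (snd p) > real (Suc n)"
        by (intro exI[of _ "(y, M)"]) simp
    qed
    then obtain p where p: "\<And>n. fst (p n) \<in> ball x (1 / real (Suc n)) \<inter> U"
        "\<And>n. snd (p n) \<in> J (fst (p n))" "\<And>n. norm (snd (p n)) > real (Suc n)"
      unfolding choice_iff by blast
    define y M where "y n = fst (p n)" and "M n = snd (p n)" for n
    have y: "\<And>n. y n \<in> ball x (1 / real (Suc n)) \<inter> U"
      and M: "\<And>n. M n \<in> J (y n)" and big: "\<And>n. norm (M n) > real (Suc n)"
      using p unfolding y_def M_def by simp_all
    have yU: "y n \<in> U" for n
      using y[of n] by simp
    have ylim: "y \<longlonglongrightarrow> x"
    proof (rule tendsto_dist_iff[THEN iffD2], rule tendsto_sandwich[OF _ _ tendsto_const LIMSEQ_inverse_real_of_nat])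
      show "eventually (\<lambda>n. dist (y n) x \<le> inverse (real (Suc n))) sequentially"
      proof (rule always_eventually, rule allI)
        show "dist (y n) x \<le> inverse (real (Suc n))" for n
          using y[of n] by (simp add: inverse_eq_divide dist_commute less_imp_le)
      qed
    qed simp
    have "\<forall>n. \<exists>P. P \<in> J\<^sub>F (g (y n)) \<and> hsnd P ** M n = - hfst P"
      using J_iff[OF yU] M by blast
    then obtain P where P: "\<And>n. P n \<in> J\<^sub>F (g (y n))" "\<And>n. hsnd (P n) ** M n = - hfst (P n)"
      unfolding choice_iff by blast
    obtain r Q where r: "strict_mono r" "(P \<circ> r) \<longlonglongrightarrow> Q" "Q \<in> J\<^sub>F (g x)"
      using subseq[OF ylim x yU P(1)] by blast
    \<comment> \<open>A limit \<open>N\<close> of the normalised \<open>M n\<close> has norm 1 and is annihilated by the invertible limit block.\<close>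
    define c where "c n = inverse (norm (M n))" for n
    define K where "K n = c n *\<^sub>R M n" for n
    have "norm (K n) = 1" for n
      using big[of n] unfolding K_def c_def by (auto simp: field_simps)
    then have "\<forall>n. (K \<circ> r) n \<in> sphere 0 1"
      by simp
    \<comment> \<open>This second extraction is made inside \<open>r\<close>, so that
      \<open>P\<close> and \<open>K\<close> converge along the same indices.\<close>
    then obtain N q where q: "N \<in> sphere 0 1" "strict_mono q" "((K \<circ> r) \<circ> q) \<longlonglongrightarrow> N"
      using compact_sphere[of "0 :: real^'n^'m" 1] unfolding compact_def by blast
    have clim: "c \<longlonglongrightarrow> 0"
    proof (rule tendsto_sandwich[OF _ _ tendsto_const LIMSEQ_inverse_real_of_nat])
      show "eventually (\<lambda>n. c n \<le> inverse (real (Suc n))) sequentially"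
      proof (rule always_eventually, rule allI)
        show "c n \<le> inverse (real (Suc n))" for n
          unfolding c_def using big[of n] by (intro le_imp_inverse_le) simp_all
      qed
    qed (simp add: c_def)
    have rq: "strict_mono (r \<circ> q)"
      using r(1) q(2) by (rule strict_mono_o)
    have Plim: "(\<lambda>n. P (r (q n))) \<longlonglongrightarrow> Q"
      using LIMSEQ_subseq_LIMSEQ[OF r(2) q(2)] by (simp add: o_def)
    \<comment> \<open>The equation is rescaled by \<open>c n\<close>. On the right, \<open>c\<close>
      tends to 0 while the blocks \<open>hfst (P (r (q n)))\<close> converge, so the product
      vanishes in the limit.\<close>
    have "hsnd (P n) ** K n = c n *\<^sub>R (- hfst (P n))" for n
      unfolding P(2)[symmetric] K_def
      by (simp add: matrix_matrix_mult_def vec_eq_iff sum_distrib_left mult_ac)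
    moreover have "(\<lambda>n. hsnd (P (r (q n))) ** K (r (q n))) \<longlonglongrightarrow> hsnd Q ** N"
      using Plim q(3) unfolding o_def by (intro tendsto_intros)
    moreover have "(\<lambda>n. c (r (q n)) *\<^sub>R (- hfst (P (r (q n))))) \<longlonglongrightarrow> 0 *\<^sub>R (- hfst Q)"
      using Plim LIMSEQ_subseq_LIMSEQ[OF clim rq] unfolding o_def by (intro tendsto_intros)
    \<comment> \<open>The form \<open>- 0\<close> matches \<open>matrix_mul_eq_minus_iff\<close>
      with the zero matrix as \<open>A\<close>.\<close>
    ultimately have "hsnd Q ** N = - 0"
      using LIMSEQ_unique by fastforce
    then have "N = - (matrix_inv (hsnd Q) ** 0)"
      using matrix_mul_eq_minus_iff[OF inv[OF x r(3)]] by metis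
    then have "N = 0"
      by (simp add: matrix_matrix_mult_def vec_eq_iff)
    with q(1) show False
      by simp
  qed

  \<comment> \<open>The chain rule along absolutely continuous curves\<close>
  have path: "AE t in lebesgue_on {0..1}. \<exists>v w.
           (\<gamma> has_vector_derivative v) (at t within {0..1}) \<and>
           ((\<lambda>s. G (\<gamma> s)) has_vector_derivative w) (at t within {0..1}) \<and>
           (\<forall>M\<in>J (\<gamma> t). w = M *v v)"
    if \<gamma>: "absolutely_continuous_on_interval 0 1 \<gamma>" "\<gamma> ` {0..1} \<subseteq> U" for \<gamma>
  proof -
    have ac: "absolutely_continuous_on_interval 0 1 (\<lambda>t. g (\<gamma> t))"
      unfolding g_def by (rule absolutely_continuous_on_interval_vcat_graph[OF assms(5) \<gamma>])
    have im: "(\<lambda>t. g (\<gamma> t)) ` {0..1} \<subseteq> W"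
      using gW \<gamma>(2) by blast
    have "AE t in lebesgue_on {0..1}. \<exists>v w.
           ((\<lambda>t. g (\<gamma> t)) has_vector_derivative v) (at t within {0..1}) \<and>
           ((\<lambda>s. F (g (\<gamma> s))) has_vector_derivative w) (at t within {0..1}) \<and>
           (\<forall>M\<in>J\<^sub>F (g (\<gamma> t)). w = M *v v)"
      using JF ac im unfolding conservative_jacobian_def by blast
    moreover have "AE t in lebesgue_on {0..1}. t \<in> {0..1::real}"
      by (rule AE_I2) simp
    ultimately show ?thesis
    proof eventually_elim
      case (elim t)
      then obtain z w where z: "((\<lambda>t. g (\<gamma> t)) has_vector_derivative z) (at t within {0..1})"
        and w: "((\<lambda>s. F (g (\<gamma> s))) has_vector_derivative w) (at t within {0..1})"
        and eq: "\<And>M. M \<in> J\<^sub>F (g (\<gamma> t)) \<Longrightarrow> w = M *v z"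
        by blast
      have tU: "\<gamma> t \<in> U"
        using elim(2) \<gamma>(2) by blast
      \<comment> \<open>\<open>F\<close> vanishes along the whole lifted curve, so uniqueness of
        derivatives within the nondegenerate interval forces \<open>w = 0\<close>, at the endpoints
        too.\<close>
      have "((\<lambda>s. F (g (\<gamma> s))) has_vector_derivative 0) (at t within {0..1})"
        by (rule has_vector_derivative_transform[OF elim(2) _ has_vector_derivative_const[of 0]])
          (use assms(6) \<gamma>(2) in \<open>auto simp: g_def image_subset_iff\<close>)
      with w elim(2) have w0: "w = 0"
        using vector_derivative_unique_within_closed_interval[of 0 1 t] by auto
      \<comment> \<open>Both blocks come from the derivative of the lifted curve alone, so they are
        fixed before any \<open>M\<close> is considered, as the quantifier order demands.\<close>
      obtain v d where vd: "z = vcat (v, d)"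
        using vcat_cases by blast
      have "(\<gamma> has_vector_derivative v) (at t within {0..1})"
        and "((\<lambda>s. G (\<gamma> s)) has_vector_derivative d) (at t within {0..1})"
        using has_vector_derivative_vcatD[OF z[unfolded g_def vd]] .
      moreover have "d = M *v v" if M: "M \<in> J (\<gamma> t)" for M
      proof -
        obtain P where P: "P \<in> J\<^sub>F (g (\<gamma> t))" "hsnd P ** M = - hfst P"
          using J_iff[OF tU] M by blast
        \<comment> \<open>With \<open>A = hfst P\<close> and \<open>B = hsnd P\<close>, the relation
          \<open>B ** M = - A\<close> turns this into \<open>B *v d = B *v (M *v v)\<close>, and
          \<open>B\<close> cancels.\<close>
        have "hfst P *v v + hsnd P *v d = 0"
          using eq[OF P(1)] w0 vd hcat_mult_vcat[of "hfst P" "hsnd P" v d] by simp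
        moreover have "hsnd P *v (M *v v) = - (hfst P *v v)"
          by (simp add: matrix_vector_mul_assoc P(2))
            (simp add: matrix_vector_mult_def vec_eq_iff sum_negf)
        ultimately have "hsnd P *v d = hsnd P *v (M *v v)"
          by (simp add: add_eq_0_iff)
        then show ?thesis
          using matrix_inv_cancel(2)[OF inv[OF tU P(1)]]
          by (metis matrix_vector_mul_assoc matrix_vector_mul_lid)
      qed
      ultimately show ?case
        by blast
    qed
  qed
  have "conservative_jacobian U G J"
    unfolding conservative_jacobian_def
    using openU assms(5) nonempty closed locbdd path by blast
  then show ?thesis
    using assms(5) unfolding path_differentiable_on_def J_def g_def by blast
qed

end
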